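(* Let $E$ be a separable Banach lattice and endow $\mathrm{Subl}(E)$, the set of closed sublattices of $E$, with the Wijsman topology. (a) For each fixed rational $\varepsilon, \tau \in (0, 1]$, the maps $F \mapsto \sigma_F(\varepsilon)$ and $F \mapsto \rho_F(\tau)$ are of Baire class $1$ on $\mathrm{Subl}(E)$. Consequently, the sets $\{F \colon \sigma_F(\varepsilon) > 0\}$ and $\{F \colon \rho_F(\tau) < r\}$ (for rational $r$) are $F_\sigma$ subsets of $\mathrm{Subl}(E)$. (b) The class $\mathrm{UM}(E)$ of uniformly monotone lattices in $\mathrm{Subl}(E)$ is a $\boldsymbol{\Pi}^0_3$ subset of $\mathrm{Subl}(E)$. (c) The class $\mathrm{(o)\text{-}USm}(E)$ of order uniformly smooth lattices in $\mathrm{Subl}(E)$ is a $\boldsymbol{\Pi}^0_3$ subset of $\mathrm{Subl}(E)$. (d) The class $\mathrm{STM}(E)$ of strictly monotone lattices in $\mathrm{Subl}(E)$ is coanalytic ($\boldsymbol{\Pi}^1_1$).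
   Context: All Banach spaces are real; $\preceq$ is the lattice order. A closed linear subspace $F\subseteq E$ is a sublattice if $\lvert y\rvert\in F$ for every $y\in F$, where $\lvert y\rvert=y\vee(-y)$; $\mathrm{Subl}(E)$ is the set of all closed sublattices of $E$, each regarded as a Banach lattice with the inherited order and norm. The Wijsman topology on the family of non-empty closed subsets of $E$, for a compatible metric $d$ on $E$, is the coarsest topology making $F\mapsto d(x,F)$ continuous for all $x$ in a dense sequence of $E$ (equivalently for all $x\in E$); $\mathrm{Subl}(E)$ carries the subspace topology, which is Polish. For a Banach lattice $X$: - $X$ is strictly monotone (STM) if $\lVert x-y\rVert<\lVert x\rVert$ whenever $0\prec y\preceq x$ (i.e. $0\preceq y\preceq x$ and $y\neq0$). - For $\varepsilon\in(0,1]$, $\delta_X(\varepsilon)=\inf\{1-\lVert x-y\rVert\colon 0\preceq y\preceq x,\ \lVert x\rVert=1,\ \lVert y\rVert\ge\varepsilon\}$; $X$ is uniformly monotone (UM) if $\delta_X(\varepsilon)>0$ for all $\varepsilon\in(0,1]$. - For $\varepsilon\in(0,1]$, $\sigma_X(\varepsilon)=\inf\{\lVert x+y\rVert-1\colon x,y\succeq0,\ \lVert x\rVert=1,\ \lVert y\rVert\ge\varepsilon\}$. Kurc's identity is $\delta_X(\varepsilon)=\sigma_X(\varepsilon)/(1+\sigma_X(\varepsilon))$, so $\delta_X(\varepsilon)>0$ if and only if $\sigma_X(\varepsilon)>0$. - For $\tau\in[0,1]$, $\rho_X(\tau)=\sup\{\lVert x\vee\tau y\rVert-1\colon x,y\succeq0,\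 \lVert x\rVert=\lVert y\rVert=1\}$; $X$ is order uniformly smooth ((o)-USm) if $\rho_X(\tau)/\tau\to0$ as $\tau\downarrow0$. Convention for the zero lattice: $\sigma_{\{0\}}(\varepsilon)=0$ and $\rho_{\{0\}}(\tau)=0$ for $\varepsilon,\tau\in(0,1]$ (so with this convention $\{0\}$ is not counted as uniformly monotone, and is counted as order uniformly smooth). A real-valued function on a Polish space is of Baire class $1$ if the preimage of every open set is $F_\sigma$. *)

theory Defs
  imports "HOL-Analysis.Analysis" "HOL-Library.Lattice_Algebras"
begin

section \<open>Banach lattices and their closed sublattices\<close>

text \<open>In \<^class>\<open>lattice_ab_group_add_abs\<close> the modulus is \<open>\<bar>a\<bar> = sup a (- a)\<close>.\<close>

class banach_lattice = banach + ordered_real_vector + lattice_ab_group_add_abs +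
  assumes norm_mono_abs: "\<bar>x\<bar> \<le> \<bar>y\<bar> \<Longrightarrow> norm x \<le> norm y"

instance real :: banach_lattice
  by standard simp

definition Subl :: "'a::banach_lattice set set" where
  "Subl = {F. closed F \<and> subspace F \<and> (\<forall>y\<in>F. \<bar>y\<bar> \<in> F)}"

section \<open>Wijsman topology\<close>

text \<open>
  The coarsest topology on the non-empty closed sets for which every function
  \<open>F \<mapsto> d(x, F) = (INF y\<in>F. d x y)\<close> is continuous; \<open>d\<close> is meant to be a metric on the whole
  type that is compatible with its topology. Taking \<open>U = UNIV\<close> shows that the points of this
  topological space are exactly the non-empty closed sets.
\<close>

definition Wijsman_topology :: "('a::topological_space \<Rightarrow> 'a \<Rightarrow> real) \<Rightarrow> 'a set topology" where
  "Wijsman_topology d =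
     topology_generated_by
       {{F. closed F \<and> F \<noteq> {} \<and> (INF y\<in>F. d x y) \<in> U} | x U. open U}"

definition Subl_topology :: "('a::banach_lattice \<Rightarrow> 'a \<Rightarrow> real) \<Rightarrow> 'a set topology" where
  "Subl_topology d = subtopology (Wijsman_topology d) Subl"

section \<open>Monotonicity and smoothness of a sublattice\<close>

text \<open>
  A closed sublattice \<open>F\<close> is regarded as a Banach lattice of its own by letting all vectors range
  over \<open>F\<close>; order, norm and lattice operations are inherited. The three moduli are set to \<open>0\<close> on
  the zero lattice, where the infimum or supremum would range over the empty set; hence the zero
  lattice is not uniformly monotone, but it is order uniformly smooth.
\<close>

definition strictly_monotone :: "'a::banach_lattice set \<Rightarrow> bool" where
  "strictly_monotone F \<longleftrightarrow>
     (\<forall>x\<in>F. \<forall>y\<in>F. 0 \<le> y \<and> y \<le> x \<and> y \<noteq> 0 \<longrightarrow> norm (x - y) < norm x)"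

definition delta_mod :: "'a::banach_lattice set \<Rightarrow> real \<Rightarrow> real" where
  "delta_mod F \<epsilon> =
     (if F = {0} then 0
      else Inf {1 - norm (x - y) | x y.
             x \<in> F \<and> y \<in> F \<and> 0 \<le> y \<and> y \<le> x \<and> norm x = 1 \<and> norm y \<ge> \<epsilon>})"

definition sigma_mod :: "'a::banach_lattice set \<Rightarrow> real \<Rightarrow> real" where
  "sigma_mod F \<epsilon> =
     (if F = {0} then 0
      else Inf {norm (x + y) - 1 | x y.
             x \<in> F \<and> y \<in> F \<and> 0 \<le> x \<and> 0 \<le> y \<and> norm x = 1 \<and> norm y \<ge> \<epsilon>})"

definition rho_mod :: "'a::banach_lattice set \<Rightarrow> real \<Rightarrow> real" where
  "rho_mod F \<tau> =
     (if F = {0} then 0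
      else Sup {norm (sup x (\<tau> *\<^sub>R y)) - 1 | x y.
             x \<in> F \<and> y \<in> F \<and> 0 \<le> x \<and> 0 \<le> y \<and> norm x = 1 \<and> norm y = 1})"

definition uniformly_monotone :: "'a::banach_lattice set \<Rightarrow> bool" where
  "uniformly_monotone F \<longleftrightarrow> (\<forall>\<epsilon>. 0 < \<epsilon> \<and> \<epsilon> \<le> 1 \<longrightarrow> delta_mod F \<epsilon> > 0)"

definition order_uniformly_smooth :: "'a::banach_lattice set \<Rightarrow> bool" where
  "order_uniformly_smooth F \<longleftrightarrow> ((\<lambda>\<tau>. rho_mod F \<tau> / \<tau>) \<longlongrightarrow> 0) (at_right 0)"

section \<open>Descriptive set theory\<close>

definition Baire_class_1 :: "'a topology \<Rightarrow> ('a \<Rightarrow> real) \<Rightarrow> bool" where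
  "Baire_class_1 X f \<longleftrightarrow> (\<forall>U. open U \<longrightarrow> fsigma_in X {x \<in> topspace X. f x \<in> U})"

definition Pi03_in :: "'a topology \<Rightarrow> 'a set \<Rightarrow> bool" where
  "Pi03_in X = (countable intersection_of fsigma_in X) relative_to topspace X"

text \<open>
  \<open>\<Sigma>\<^sup>1\<^sub>1\<close> sets: the projections to \<open>X\<close> of the closed subsets of \<open>X \<times> \<nat>\<^sup>\<nat>\<close>, where the Baire space
  \<open>\<nat>\<^sup>\<nat>\<close> is the type \<^typ>\<open>nat \<Rightarrow> nat\<close> with its product topology. For Polish \<open>X\<close> these are the continuous
  images of Polish spaces.
\<close>

definition analytic_in :: "'a topology \<Rightarrow> 'a set \<Rightarrow> bool" where
  "analytic_in X S \<longleftrightarrow>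
     (\<exists>C. closedin (prod_topology X (euclidean :: (nat \<Rightarrow> nat) topology)) C \<and> S = fst ` C)"

definition coanalytic_in :: "'a topology \<Rightarrow> 'a set \<Rightarrow> bool" where
  "coanalytic_in X S \<longleftrightarrow> S \<subseteq> topspace X \<and> analytic_in X (topspace X - S)"

end

theory Submission
  imports Defs
begin

text \<open>
  Call the set of all \<open>F \<in> Subl\<close> such that \<open>F \<times> F\<close> meets an open set \<open>W\<close> the hit set of \<open>W\<close>. The proof rests on
  one topological fact: hit sets are open and at the same time \<open>F\<^sub>\<sigma>\<close> in the Wijsman topology
  (\<open>openin_hits\<close>, \<open>fsigma_in_hits\<close>). Indeed, \<open>F\<close> meets the ball of radius \<open>r\<close> about \<open>a\<close> exactly if the continuous
  function \<open>F \<mapsto> d(a, F)\<close> is below \<open>r\<close>, which is an open condition and the union of the closed conditions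
  \<open>d(a, F) \<le> r - 1/n\<close>; and by separability \<open>W\<close> is a countable union of products of balls.

  The conditions on the vectors in the definition of \<open>sigma_mod\<close> and \<open>rho_mod\<close> are closed, not open. Since \<open>F\<close> is
  closed under moduli and scaling, arbitrary vectors of \<open>F\<close> can be made positive and normalised, and the
  lattice operations are continuous. In this homogeneous form the statements \<open>sigma_mod F \<epsilon> < r\<close> and
  \<open>r < rho_mod F \<tau>\<close> say that a nonzero \<open>F\<close> lies in a certain hit set (\<open>sigma_mod_less_iff_homogeneous\<close>,
  \<open>less_rho_mod_iff_homogeneous\<close>). So one kind of strict sublevel or superlevel set is open and \<open>F\<^sub>\<sigma>\<close>, the other
  kind is a countable union of closed sets, and the moduli are of Baire class 1.

  Uniform monotonicity is positivity of \<open>sigma_mod\<close> at all \<open>1/n\<close>; order uniform smoothness says that for each \<open>k\<close> there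
  is an \<open>m\<close> with \<open>rho_mod F (1/m) < 1/(m k)\<close>, because \<open>rho_mod F \<tau> / \<tau>\<close> is nondecreasing in \<open>\<tau>\<close>. Both are countable
  intersections of \<open>F\<^sub>\<sigma>\<close> sets.

  A failure of strict monotonicity has a witness \<open>0 \<le> y \<le> x\<close> in \<open>F\<close> with \<open>norm y = 1\<close> and \<open>norm x \<le> norm (x - y)\<close>. These
  conditions are closed in \<open>(F, x, y)\<close>, so the failures form the projection of a closed set along a Polish space. A
  continuous surjection from the Baire space onto that Polish space
  (\<open>Baire_space_continuous_surjection\<close>) brings the projection into the form that defines analytic sets.
\<close>

section \<open>The norm and the lattice operations of a Banach lattice\<close>

lemma norm_abs_lattice: "norm \<bar>x\<bar> = norm (x :: 'a::banach_lattice)"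
  by (intro antisym norm_mono_abs) simp_all

lemma norm_mono_nonneg: "0 \<le> x \<Longrightarrow> x \<le> y \<Longrightarrow> norm x \<le> norm (y :: 'a::banach_lattice)"
  by (rule norm_mono_abs) (simp add: abs_of_nonneg order_trans[of 0 x y])

text \<open>Multiplication by \<open>c\<close> is an order isomorphism with inverse multiplication by \<open>inverse c\<close>, so it
  preserves suprema.\<close>

lemma scaleR_sup_pos:
  fixes x y :: "'a::banach_lattice"
  assumes "0 < c"
  shows "c *\<^sub>R sup x y = sup (c *\<^sub>R x) (c *\<^sub>R y)"
proof (rule antisym)
  have "sup x y \<le> inverse c *\<^sub>R sup (c *\<^sub>R x) (c *\<^sub>R y)"
  proof (rule sup_least)
    have "inverse c *\<^sub>R (c *\<^sub>R x) \<le> inverse c *\<^sub>R sup (c *\<^sub>R x) (c *\<^sub>R y)"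
      using assms by (intro scaleR_left_mono) auto
    then show "x \<le> inverse c *\<^sub>R sup (c *\<^sub>R x) (c *\<^sub>R y)" using assms by simp
    have "inverse c *\<^sub>R (c *\<^sub>R y) \<le> inverse c *\<^sub>R sup (c *\<^sub>R x) (c *\<^sub>R y)"
      using assms by (intro scaleR_left_mono) auto
    then show "y \<le> inverse c *\<^sub>R sup (c *\<^sub>R x) (c *\<^sub>R y)" using assms by simp
  qed
  then have "c *\<^sub>R sup x y \<le> c *\<^sub>R (inverse c *\<^sub>R sup (c *\<^sub>R x) (c *\<^sub>R y))"
    using assms by (intro scaleR_left_mono) auto
  then show "c *\<^sub>R sup x y \<le> sup (c *\<^sub>R x) (c *\<^sub>R y)" using assms by simp
next
  show "sup (c *\<^sub>R x) (c *\<^sub>R y) \<le> c *\<^sub>R sup x y"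
    using assms by (intro sup_least scaleR_left_mono) auto
qed

text \<open>The modulus is a contraction: the norm is monotone in the modulus, and
  \<open>\<bar>\<bar>x\<bar> - \<bar>y\<bar>\<bar> \<le> \<bar>x - y\<bar>\<close> holds in every lattice-ordered group.\<close>

lemma continuous_on_abs_lattice:
  fixes f :: "'b::topological_space \<Rightarrow> 'a::banach_lattice"
  assumes "continuous_on S f"
  shows "continuous_on S (\<lambda>x. \<bar>f x\<bar>)"
proof -
  have "norm (\<bar>x\<bar> - \<bar>y\<bar>) \<le> 1 * norm (x - y)" for x y :: 'a
    using norm_mono_abs[OF abs_triangle_ineq3[of x y]] by simp
  then have "1-lipschitz_on UNIV (abs :: 'a \<Rightarrow> 'a)"
    by (intro lipschitz_onI) (auto simp: dist_norm)
  then have "continuous_on UNIV (abs :: 'a \<Rightarrow> 'a)"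
    by (rule lipschitz_on_continuous_on)
  then show ?thesis
    using assms continuous_on_compose2 by blast
qed

text \<open>This reduces the continuity of the supremum to that of the modulus.\<close>

lemma sup_eq_half_abs:
  fixes x y :: "'a::banach_lattice"
  shows "sup x y = (1/2) *\<^sub>R (x + y + \<bar>y - x\<bar>)"
proof -
  have "sup x y = x + pprt (y - x)"
    by (simp add: pprt_def add_sup_distrib_left sup_commute)
  moreover have "pprt z = (1/2) *\<^sub>R (z + \<bar>z\<bar>)" for z :: 'a
  proof -
    have "z + \<bar>z\<bar> = (pprt z + nprt z) + (pprt z - nprt z)"
      by (simp only: abs_prts prts[symmetric])
    also have "\<dots> = 2 *\<^sub>R pprt z"
      by (simp add: scaleR_2)
    finally show ?thesis by simp
  qed
  ultimately have "sup x y = x + (1/2) *\<^sub>R (y - x + \<bar>y - x\<bar>)"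
    by simp
  also have "x = (1/2) *\<^sub>R x + (1/2) *\<^sub>R x"
    by (simp flip: scaleR_left_distrib)
  then have "x + (1/2) *\<^sub>R (y - x + \<bar>y - x\<bar>)
      = (1/2) *\<^sub>R x + (1/2) *\<^sub>R x + (1/2) *\<^sub>R (y - x + \<bar>y - x\<bar>)"
    by metis
  also have "\<dots> = (1/2) *\<^sub>R (x + y + \<bar>y - x\<bar>)"
    by (simp add: algebra_simps)
  finally show ?thesis .
qed

lemma continuous_on_sup_lattice:
  fixes f g :: "'b::topological_space \<Rightarrow> 'a::banach_lattice"
  assumes "continuous_on S f" "continuous_on S g"
  shows "continuous_on S (\<lambda>x. sup (f x) (g x))"
  unfolding sup_eq_half_abs using assms by (intro continuous_intros continuous_on_abs_lattice)

text \<open>The positive cone is the equaliser of the modulus and the identity, hence closed.\<close>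

lemma closed_Collect_le_lattice:
  fixes f g :: "'b::topological_space \<Rightarrow> 'a::banach_lattice"
  assumes "continuous_on UNIV f" "continuous_on UNIV g"
  shows "closed {x. f x \<le> g x}"
proof -
  have "{x. f x \<le> g x} = {x. \<bar>g x - f x\<bar> = g x - f x}"
    by (metis (no_types) abs_ge_zero abs_of_nonneg diff_ge_0_iff_ge)
  then show ?thesis
    using assms by (auto intro!: closed_Collect_eq continuous_intros continuous_on_abs_lattice)
qed

section \<open>Homogeneous forms of the moduli\<close>

lemma SublD:
  assumes "F \<in> Subl"
  shows "closed F" "subspace F" "y \<in> F \<Longrightarrow> \<bar>y\<bar> \<in> F" "0 \<in> F"
  using assms by (auto simp: Subl_def subspace_0)

lemma zero_in_Subl: "{0} \<in> Subl"
  by (auto simp: Subl_def subspace_def)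

lemma Subl_scale_abs: "F \<in> Subl \<Longrightarrow> y \<in> F \<Longrightarrow> c *\<^sub>R \<bar>y\<bar> \<in> F"
  by (meson SublD subspace_scale)

lemma Subl_nontrivial:
  assumes "F \<in> Subl"
  shows "F \<noteq> {0} \<longleftrightarrow> (\<exists>x\<in>F. x \<noteq> 0)"
  using SublD(4)[OF assms] by auto

lemma Subl_unit_vector:
  assumes "F \<in> Subl" "F \<noteq> {0}"
  obtains x where "x \<in> F" "0 \<le> x" "norm x = 1"
proof -
  obtain z where "z \<in> F" "z \<noteq> 0" using assms Subl_nontrivial by blast
  then show ?thesis
    using Subl_scale_abs[OF assms(1), of z "inverse (norm z)"]
    by (intro that[of "inverse (norm z) *\<^sub>R \<bar>z\<bar>"]) (auto simp: norm_abs_lattice scaleR_nonneg_nonneg)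
qed

lemma norm_add_ge:
  assumes "0 \<le> x" "0 \<le> y"
  shows "norm x \<le> norm (x + y :: 'a::banach_lattice)"
  using assms by (intro norm_mono_nonneg) auto

lemma sigma_mod_less_iff:
  assumes F: "F \<in> Subl" "F \<noteq> {0}" and \<epsilon>: "\<epsilon> \<le> 1"
  shows "sigma_mod F \<epsilon> < r \<longleftrightarrow>
    (\<exists>x\<in>F. \<exists>y\<in>F. 0 \<le> x \<and> 0 \<le> y \<and> norm x = 1 \<and> norm y \<ge> \<epsilon> \<and> norm (x + y) - 1 < r)"
    (is "_ \<longleftrightarrow> ?R")
proof -
  let ?S = "{norm (x + y) - 1 | x y.
             x \<in> F \<and> y \<in> F \<and> 0 \<le> x \<and> 0 \<le> y \<and> norm x = 1 \<and> norm y \<ge> \<epsilon>}"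
  obtain z where "z \<in> F" "0 \<le> z" "norm z = 1" using Subl_unit_vector[OF F] .
  then have "norm (z + z) - 1 \<in> ?S"
    using \<epsilon> by (intro CollectI exI[of _ z]) auto
  then have "?S \<noteq> {}" by blast
  moreover have "bdd_below ?S"
    by (intro bdd_belowI[of _ 0]) (auto, metis norm_add_ge)
  ultimately have "Inf ?S < r \<longleftrightarrow> (\<exists>s\<in>?S. s < r)"
    by (rule cInf_less_iff)
  then show ?thesis unfolding sigma_mod_def using F by auto
qed

text \<open>The vectors \<open>\<bar>u\<bar>\<close> and \<open>\<bar>v\<bar>\<close>, divided by \<open>norm u\<close>, form an admissible pair of the infimum. This
  removes the closed conditions (positivity and normalisation): what is left is that \<open>F \<times> F\<close> meets a fixed
  open subset of the square of the space. The condition on the norm of \<open>v\<close> may be strict because the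
  inequality on the sum is strict and leaves room to enlarge \<open>v\<close>.\<close>

lemma sigma_mod_less_iff_homogeneous:
  assumes F: "F \<in> Subl" "F \<noteq> {0}" and \<epsilon>: "0 < \<epsilon>" "\<epsilon> \<le> 1"
  shows "sigma_mod F \<epsilon> < r \<longleftrightarrow>
    (\<exists>u\<in>F. \<exists>v\<in>F. norm v > \<epsilon> * norm u \<and> norm (\<bar>u\<bar> + \<bar>v\<bar>) < (1 + r) * norm u)"
    (is "_ \<longleftrightarrow> ?R")
proof
  assume "sigma_mod F \<epsilon> < r"
  then obtain x y where xy: "x \<in> F" "y \<in> F" "0 \<le> x" "0 \<le> y" "norm x = 1" "norm y \<ge> \<epsilon>"
      "norm (x + y) < 1 + r"
    using sigma_mod_less_iff[OF F \<epsilon>(2)] by force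
  \<comment> \<open>Stretching \<open>y\<close> slightly makes its norm exceed \<open>\<epsilon>\<close> strictly and keeps the sum small.\<close>
  define \<eta> where "\<eta> = (1 + r - norm (x + y)) / (2 * norm y)"
  have y0: "norm y > 0" using xy \<epsilon> by linarith
  then have \<eta>0: "\<eta> > 0" using xy by (simp add: \<eta>_def)
  define v where "v = (1 + \<eta>) *\<^sub>R y"
  have "norm (x + v) \<le> norm (x + y) + \<eta> * norm y"
    using norm_triangle_ineq[of "x + y" "\<eta> *\<^sub>R y"] \<eta>0 by (simp add: v_def algebra_simps)
  also have "\<eta> * norm y = (1 + r - norm (x + y)) / 2" using y0 by (simp add: \<eta>_def)
  also have "norm (x + y) + (1 + r - norm (x + y)) / 2 < 1 + r" using xy(7) by (simp add: field_simps)
  finally have "norm (x + v) < 1 + r" .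
  moreover have "norm v = norm y + \<eta> * norm y" 
    unfolding v_def norm_scaleR using \<eta>0 by (simp add: distrib_right)
  then have "norm v > \<epsilon>" using xy mult_pos_pos[OF \<eta>0 y0] by linarith
  moreover have "v \<in> F" using SublD(2)[OF F(1)] xy(2) by (simp add: v_def subspace_scale)
  moreover have "0 \<le> v" using \<eta>0 xy by (simp add: v_def scaleR_nonneg_nonneg)
  ultimately show ?R
    using xy by (intro bexI[of _ x] bexI[of _ v]) (auto simp: abs_of_nonneg)
next
  assume ?R
  then obtain u v where uv: "u \<in> F" "v \<in> F" "norm v > \<epsilon> * norm u"
    "norm (\<bar>u\<bar> + \<bar>v\<bar>) < (1 + r) * norm u" by blast
  have "u \<noteq> 0" using uv(4) by auto
  then have u0: "norm u > 0" by simp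
  define c where "c = inverse (norm u)"
  have c0: "c > 0" using u0 by (simp add: c_def)
  define x where "x = c *\<^sub>R \<bar>u\<bar>"
  define y where "y = c *\<^sub>R \<bar>v\<bar>"
  have "x + y = c *\<^sub>R (\<bar>u\<bar> + \<bar>v\<bar>)" by (simp add: x_def y_def scaleR_right_distrib)
  then have "norm (x + y) = norm (\<bar>u\<bar> + \<bar>v\<bar>) / norm u"
    using u0 by (simp add: c_def divide_inverse_commute)
  then have "norm (x + y) < 1 + r" using uv u0 by (simp add: divide_less_eq)
  moreover have "norm y = norm v / norm u"
    using u0 by (simp add: y_def c_def norm_abs_lattice divide_inverse_commute)
  then have "norm y \<ge> \<epsilon>" using uv(3) u0 by (simp add: le_divide_eq)
  moreover have "norm x = 1" using u0 by (simp add: x_def c_def norm_abs_lattice)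
  moreover have "x \<in> F" "y \<in> F" unfolding x_def y_def using F(1) uv Subl_scale_abs by blast+
  moreover have "0 \<le> x" "0 \<le> y" using c0 by (auto simp: x_def y_def scaleR_nonneg_nonneg)
  ultimately show "sigma_mod F \<epsilon> < r"
    unfolding sigma_mod_less_iff[OF F \<epsilon>(2)] by force
qed

lemma norm_sup_scale_bounds:
  fixes x y :: "'a::banach_lattice"
  assumes "0 \<le> x" "0 \<le> y" "norm x = 1" "norm y = 1" "0 \<le> t"
  shows "1 \<le> norm (sup x (t *\<^sub>R y))" "norm (sup x (t *\<^sub>R y)) \<le> 1 + t"
proof -
  have ty: "0 \<le> t *\<^sub>R y" using assms by (simp add: scaleR_nonneg_nonneg)
  show "1 \<le> norm (sup x (t *\<^sub>R y))"
    using norm_mono_nonneg[of x "sup x (t *\<^sub>R y)"] assms by simp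
  have "sup x (t *\<^sub>R y) \<le> x + t *\<^sub>R y" using assms ty by simp
  moreover have "0 \<le> sup x (t *\<^sub>R y)" using assms(1) by (simp add: le_supI1)
  ultimately have "norm (sup x (t *\<^sub>R y)) \<le> norm (x + t *\<^sub>R y)"
    using norm_mono_nonneg by blast
  also have "\<dots> \<le> 1 + t" using norm_triangle_ineq[of x "t *\<^sub>R y"] assms by simp
  finally show "norm (sup x (t *\<^sub>R y)) \<le> 1 + t" .
qed

lemma less_rho_mod_iff:
  assumes F: "F \<in> Subl" "F \<noteq> {0}" and \<tau>: "0 \<le> \<tau>"
  shows "r < rho_mod F \<tau> \<longleftrightarrow>
    (\<exists>x\<in>F. \<exists>y\<in>F. 0 \<le> x \<and> 0 \<le> y \<and> norm x = 1 \<and> norm y = 1 \<and> r < norm (sup x (\<tau> *\<^sub>R y)) - 1)"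
proof -
  let ?S = "{norm (sup x (\<tau> *\<^sub>R y)) - 1 | x y.
             x \<in> F \<and> y \<in> F \<and> 0 \<le> x \<and> 0 \<le> y \<and> norm x = 1 \<and> norm y = 1}"
  obtain z where "z \<in> F" "0 \<le> z" "norm z = 1" using Subl_unit_vector[OF F] .
  then have "norm (sup z (\<tau> *\<^sub>R z)) - 1 \<in> ?S" by blast
  then have "?S \<noteq> {}" by blast
  moreover have "bdd_above ?S"
  proof (intro bdd_aboveI[of _ \<tau>])
    fix s assume "s \<in> ?S"
    then obtain x y where "x \<in> F" "s = norm (sup x (\<tau> *\<^sub>R y)) - 1"
        "0 \<le> x" "0 \<le> y" "norm x = 1" "norm y = 1"
      by blast
    then show "s \<le> \<tau>" using norm_sup_scale_bounds(2)[of x y \<tau>] \<tau> by linarith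
  qed
  ultimately have "r < Sup ?S \<longleftrightarrow> (\<exists>s\<in>?S. r < s)"
    by (rule less_cSup_iff)
  then show ?thesis unfolding rho_mod_def using F by auto
qed

text \<open>As for \<open>sigma_mod\<close>, normalising \<open>\<bar>u\<bar>\<close> and \<open>\<bar>v\<bar>\<close> turns an inequality for the supremum into the
  existence of a pair from \<open>F \<times> F\<close> in a fixed open set. The inequality is multiplied by
  \<open>norm u * norm v\<close>, so that it fails by itself when one of the vectors vanishes.\<close>

lemma less_rho_mod_iff_homogeneous:
  assumes F: "F \<in> Subl" "F \<noteq> {0}" and \<tau>: "0 \<le> \<tau>"
  shows "r < rho_mod F \<tau> \<longleftrightarrow>
    (\<exists>u\<in>F. \<exists>v\<in>F. (1 + r) * norm u * norm v
        < norm (sup (norm v *\<^sub>R \<bar>u\<bar>) ((\<tau> * norm u) *\<^sub>R \<bar>v\<bar>)))" (is "_ \<longleftrightarrow> ?R")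
proof
  assume "r < rho_mod F \<tau>"
  then obtain x y where xy: "x \<in> F" "y \<in> F" "0 \<le> x" "0 \<le> y" "norm x = 1" "norm y = 1"
      "r < norm (sup x (\<tau> *\<^sub>R y)) - 1"
    using less_rho_mod_iff[OF F \<tau>] by blast
  then show ?R by (intro bexI[of _ x] bexI[of _ y]) (auto simp: abs_of_nonneg)
next
  assume ?R
  then obtain u v where uv: "u \<in> F" "v \<in> F" and less: "(1 + r) * norm u * norm v
        < norm (sup (norm v *\<^sub>R \<bar>u\<bar>) ((\<tau> * norm u) *\<^sub>R \<bar>v\<bar>))" by blast
  have "u \<noteq> 0" "v \<noteq> 0" using less by auto
  then have nz: "norm u > 0" "norm v > 0" by auto
  define x where "x = inverse (norm u) *\<^sub>R \<bar>u\<bar>"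
  define y where "y = inverse (norm v) *\<^sub>R \<bar>v\<bar>"
  have "sup (norm v *\<^sub>R \<bar>u\<bar>) ((\<tau> * norm u) *\<^sub>R \<bar>v\<bar>) = (norm u * norm v) *\<^sub>R sup x (\<tau> *\<^sub>R y)"
    using nz by (simp add: x_def y_def scaleR_sup_pos field_simps)
  then have "(norm u * norm v) * (1 + r) < (norm u * norm v) * norm (sup x (\<tau> *\<^sub>R y))"
    using less by (simp add: mult_ac)
  then have "1 + r < norm (sup x (\<tau> *\<^sub>R y))"
    using nz by (simp add: mult_less_cancel_left_pos)
  moreover have "norm x = 1" "norm y = 1" using nz by (auto simp: x_def y_def norm_abs_lattice)
  moreover have "x \<in> F" "y \<in> F" unfolding x_def y_def using F(1) uv Subl_scale_abs by blast+
  moreover have "0 \<le> x" "0 \<le> y" using nz by (auto simp: x_def y_def scaleR_nonneg_nonneg)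
  ultimately show "r < rho_mod F \<tau>"
    unfolding less_rho_mod_iff[OF F \<tau>] by force
qed

text \<open>A failure of strict monotonicity is invariant under positive scaling, so the open condition \<open>y \<noteq> 0\<close> can be
  replaced by the closed condition \<open>norm y = 1\<close>.\<close>

lemma not_strictly_monotone_iff:
  assumes F: "F \<in> Subl"
  shows "\<not> strictly_monotone F \<longleftrightarrow>
    (\<exists>x\<in>F. \<exists>y\<in>F. 0 \<le> y \<and> y \<le> x \<and> norm y = 1 \<and> norm x \<le> norm (x - y))" (is "_ \<longleftrightarrow> ?R")
proof
  assume "\<not> strictly_monotone F"
  then obtain x y where xy: "x \<in> F" "y \<in> F" "0 \<le> y" "y \<le> x" "y \<noteq> 0" "norm x \<le> norm (x - y)"
    unfolding strictly_monotone_def by (meson not_le)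
  define c where "c = inverse (norm y)"
  have c: "c > 0" "c * norm y = 1" using xy by (auto simp: c_def)
  have "norm (c *\<^sub>R x - c *\<^sub>R y) = c * norm (x - y)"
    using c by (simp flip: scaleR_right_diff_distrib)
  then have "norm (c *\<^sub>R x) \<le> norm (c *\<^sub>R x - c *\<^sub>R y)" using xy c by simp
  moreover have "c *\<^sub>R x \<in> F" "c *\<^sub>R y \<in> F" using xy SublD(2)[OF F] by (auto simp: subspace_scale)
  moreover have "0 \<le> c *\<^sub>R y" "c *\<^sub>R y \<le> c *\<^sub>R x" "norm (c *\<^sub>R y) = 1"
    using xy c by (auto simp: scaleR_nonneg_nonneg scaleR_left_mono)
  ultimately show ?R by blast
next
  assume ?R
  then show "\<not> strictly_monotone F"
    unfolding strictly_monotone_def by (metis norm_zero not_le zero_neq_one)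
qed

section \<open>Uniform monotonicity and order uniform smoothness through countably many moduli\<close>

lemma sigma_mod_mono:
  assumes F: "F \<in> Subl" and "\<epsilon> \<le> \<epsilon>'" "\<epsilon>' \<le> 1"
  shows "sigma_mod F \<epsilon> \<le> sigma_mod F \<epsilon>'"
proof (cases "F = {0}")
  case False
  show ?thesis
  proof (rule ccontr)
    assume "\<not> ?thesis"
    then have "sigma_mod F \<epsilon>' < sigma_mod F \<epsilon>" by simp
    then have "sigma_mod F \<epsilon> < sigma_mod F \<epsilon>"
      using assms sigma_mod_less_iff[OF F False, of \<epsilon>' "sigma_mod F \<epsilon>"]
        sigma_mod_less_iff[OF F False, of \<epsilon> "sigma_mod F \<epsilon>"] by (meson order_trans)
    then show False by simp
  qed
qed (simp add: sigma_mod_def)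

lemma delta_mod_less_iff:
  assumes F: "F \<in> Subl" "F \<noteq> {0}" and \<epsilon>: "\<epsilon> \<le> 1"
  shows "delta_mod F \<epsilon> < r \<longleftrightarrow>
    (\<exists>x\<in>F. \<exists>y\<in>F. 0 \<le> y \<and> y \<le> x \<and> norm x = 1 \<and> norm y \<ge> \<epsilon> \<and> 1 - norm (x - y) < r)"
proof -
  let ?S = "{1 - norm (x - y) | x y.
             x \<in> F \<and> y \<in> F \<and> 0 \<le> y \<and> y \<le> x \<and> norm x = 1 \<and> norm y \<ge> \<epsilon>}"
  obtain z where "z \<in> F" "0 \<le> z" "norm z = 1" using Subl_unit_vector[OF F] .
  then have "1 - norm (z - z) \<in> ?S"
    using \<epsilon> by (intro CollectI exI[of _ z]) auto
  then have "?S \<noteq> {}" by blast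
  moreover have "bdd_below ?S"
  proof (intro bdd_belowI[of _ 0])
    fix s assume "s \<in> ?S"
    then obtain x y where "x \<in> F" "s = 1 - norm (x - y)" "0 \<le> y" "y \<le> x" "norm x = 1"
      by blast
    then show "0 \<le> s" using norm_mono_nonneg[of "x - y" x] by simp
  qed
  ultimately have "Inf ?S < r \<longleftrightarrow> (\<exists>s\<in>?S. s < r)"
    by (rule cInf_less_iff)
  then show ?thesis unfolding delta_mod_def using F by auto
qed

text \<open>Split \<open>x\<close> into \<open>z = x - y\<close> and \<open>y\<close>. Dividing by \<open>norm z \<le> 1\<close> only enlarges \<open>y\<close>, so
  \<open>1 = norm (z + y) \<ge> (1 + s) * norm z\<close> with \<open>s = sigma_mod F \<epsilon>\<close>, which keeps \<open>norm z\<close> away from \<open>1\<close>.\<close>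

lemma delta_mod_pos_if_sigma_mod_pos:
  assumes F: "F \<in> Subl" and \<epsilon>: "0 < \<epsilon>" "\<epsilon> \<le> 1" and pos: "sigma_mod F \<epsilon> > 0"
  shows "delta_mod F \<epsilon> > 0"
proof -
  have nt: "F \<noteq> {0}" using pos by (auto simp: sigma_mod_def)
  define s where "s = sigma_mod F \<epsilon>"
  define q where "q = 1 / (1 + s)"
  have s0: "s > 0" and q: "0 < q" "q < 1" using pos by (auto simp: s_def q_def field_simps)
  have "\<not> delta_mod F \<epsilon> < 1 - q"
  proof
    assume "delta_mod F \<epsilon> < 1 - q"
    then obtain x y where xy: "x \<in> F" "y \<in> F" "0 \<le> y" "y \<le> x" "norm x = 1" "norm y \<ge> \<epsilon>"
        "q < norm (x - y)"
      using delta_mod_less_iff[OF F nt \<epsilon>(2)] by force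
    define z where "z = x - y"
    have z: "0 \<le> z" "norm z > q" "norm z \<le> 1" "z \<in> F"
      using xy norm_mono_nonneg[of z x] subspace_diff[OF SublD(2)[OF F]] by (auto simp: z_def)
    have "norm (\<bar>z\<bar> + \<bar>y\<bar>) = 1" using xy z by (simp add: abs_of_nonneg z_def)
    also have "1 < (1 + s) * norm z" using z(2) s0 by (simp add: q_def field_simps)
    finally have *: "norm (\<bar>z\<bar> + \<bar>y\<bar>) < (1 + s) * norm z" .
    define c where "c = inverse (norm z)"
    have "norm z \<noteq> 0" using z(2) q by linarith
    then have cz: "c * norm z = 1" unfolding c_def by (rule left_inverse)
    have c: "c > 0" "c \<ge> 1" using z q by (auto simp: c_def one_le_inverse_iff)
    have "norm (c *\<^sub>R z + c *\<^sub>R y) = c * norm (\<bar>z\<bar> + \<bar>y\<bar>)"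
      using xy(3) z(1) c by (simp add: abs_of_nonneg flip: scaleR_right_distrib)
    also have "\<dots> < c * ((1 + s) * norm z)" using * c by simp
    also have "\<dots> = 1 + s"
    using cz by (metis mult.left_commute mult.right_neutral)
    finally have "norm (c *\<^sub>R z + c *\<^sub>R y) - 1 < s" by simp
    moreover have "norm (c *\<^sub>R z) = 1" using cz c by simp
    moreover have "norm (c *\<^sub>R y) \<ge> \<epsilon>"
      using c xy(6) \<epsilon> mult_mono[of 1 c \<epsilon> "norm y"] by simp
    moreover have "0 \<le> c *\<^sub>R z" "0 \<le> c *\<^sub>R y" using c xy z by (auto simp: scaleR_nonneg_nonneg)
    moreover have "c *\<^sub>R z \<in> F" "c *\<^sub>R y \<in> F" using xy z SublD(2)[OF F] by (auto simp: subspace_scale)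
    ultimately have "sigma_mod F \<epsilon> < s" using sigma_mod_less_iff[OF F nt \<epsilon>(2)] by blast
    then show False by (simp add: s_def)
  qed
  then show ?thesis using q by simp
qed

text \<open>Dividing \<open>x + y\<close> by its norm \<open>w\<close> shrinks \<open>y\<close>. If \<open>w \<ge> 2\<close>, nothing has to be shown; otherwise \<open>y\<close>
  keeps at least half of its norm, and the modulus at \<open>\<epsilon> / 2\<close> bounds \<open>w\<close> away from \<open>1\<close>. Losing the factor
  \<open>2\<close> is harmless for a condition that is imposed at all \<open>\<epsilon>\<close>.\<close>

lemma sigma_mod_pos_if_delta_mod_pos:
  assumes F: "F \<in> Subl" and \<epsilon>: "0 < \<epsilon>" "\<epsilon> \<le> 1" and pos: "delta_mod F (\<epsilon> / 2) > 0"
  shows "sigma_mod F \<epsilon> > 0"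
proof -
  have nt: "F \<noteq> {0}" using pos by (auto simp: delta_mod_def)
  have e2: "\<epsilon> / 2 \<le> 1" using \<epsilon> by simp
  define t where "t = min 1 (delta_mod F (\<epsilon> / 2))"
  have t0: "0 < t" "t \<le> 1" using pos by (auto simp: t_def)
  have "\<not> sigma_mod F \<epsilon> < t"
  proof
    assume "sigma_mod F \<epsilon> < t"
    then obtain x y where xy: "x \<in> F" "y \<in> F" "0 \<le> x" "0 \<le> y" "norm x = 1" "norm y \<ge> \<epsilon>"
        "norm (x + y) < 1 + t"
      using sigma_mod_less_iff[OF F nt \<epsilon>(2)] by force
    define w where "w = norm (x + y)"
    have w: "1 \<le> w" "w < 1 + t" "w < 2" using xy norm_add_ge[of x y] t0 by (auto simp: w_def)
    define c where "c = inverse w"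
    have c: "0 < c" "1/2 \<le> c" using w by (auto simp: c_def field_simps)
    have "norm (c *\<^sub>R y) \<ge> \<epsilon> / 2"
      using c xy(6) \<epsilon> mult_mono[of "1/2" c \<epsilon> "norm y"] by simp
    moreover have "norm (c *\<^sub>R (x + y)) = 1" using w c by (simp add: c_def w_def)
    moreover have "c *\<^sub>R (x + y) - c *\<^sub>R y = c *\<^sub>R x" by (simp add: scaleR_right_distrib)
    then have "norm (c *\<^sub>R (x + y) - c *\<^sub>R y) = c" using c xy by simp
    moreover have "1 - c < t"
    proof -
      have "1 - c = (w - 1) / w" using w by (simp add: c_def field_simps)
      also have "\<dots> \<le> w - 1" using w by (simp add: divide_le_eq mult_le_cancel_left1)
      finally show ?thesis using w by simp
    qed
    moreover have "0 \<le> c *\<^sub>R y" "c *\<^sub>R y \<le> c *\<^sub>R (x + y)"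
      using c xy by (auto simp: scaleR_nonneg_nonneg intro!: scaleR_left_mono)
    moreover have "c *\<^sub>R (x + y) \<in> F" "c *\<^sub>R y \<in> F"
      using xy SublD(2)[OF F] by (auto simp: subspace_scale subspace_add)
    ultimately have "delta_mod F (\<epsilon> / 2) < t"
      unfolding delta_mod_less_iff[OF F nt e2] by (metis)
    then show False by (simp add: t_def)
  qed
  then show ?thesis using t0 by simp
qed

lemma uniformly_monotone_iff_sigma_mod:
  assumes F: "F \<in> Subl"
  shows "uniformly_monotone F \<longleftrightarrow> (\<forall>n. sigma_mod F (1 / real (Suc n)) > 0)"
proof
  assume "uniformly_monotone F"
  then show "\<forall>n. sigma_mod F (1 / real (Suc n)) > 0"
    unfolding uniformly_monotone_def
    by (intro allI sigma_mod_pos_if_delta_mod_pos[OF F]) (auto simp: divide_le_eq)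
next
  assume R: "\<forall>n. sigma_mod F (1 / real (Suc n)) > 0"
  show "uniformly_monotone F"
    unfolding uniformly_monotone_def
  proof (intro allI impI)
    fix \<epsilon> :: real assume \<epsilon>: "0 < \<epsilon> \<and> \<epsilon> \<le> 1"
    then obtain n where "1 / real (Suc n) < \<epsilon>" using nat_approx_posE by blast
    then have "sigma_mod F (1 / real (Suc n)) \<le> sigma_mod F \<epsilon>"
      using \<epsilon> by (intro sigma_mod_mono[OF F]) auto
    then show "delta_mod F \<epsilon> > 0"
      using \<epsilon> R delta_mod_pos_if_sigma_mod_pos[OF F] by (meson less_le_trans)
  qed
qed

lemma rho_mod_nonneg:
  assumes F: "F \<in> Subl" and "0 \<le> \<tau>"
  shows "0 \<le> rho_mod F \<tau>"
proof (cases "F = {0}")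
  case False
  obtain z where z: "z \<in> F" "0 \<le> z" "norm z = 1" using Subl_unit_vector[OF F False] .
  then have "1 \<le> norm (sup z (\<tau> *\<^sub>R z))" using norm_sup_scale_bounds(1) assms(2) by blast
  then have "\<forall>r<0. r < rho_mod F \<tau>"
    using less_rho_mod_iff[OF F False assms(2)] z by force
  then show ?thesis by (meson dense less_asym not_le)
qed (simp add: rho_mod_def)

text \<open>For fixed positive \<open>x\<close> and \<open>y\<close>, the norm of \<open>sup x (\<tau> *\<^sub>R y)\<close> is a convex function of \<open>\<tau>\<close> with value
  \<open>norm x\<close> at \<open>0\<close>. Hence \<open>rho_mod F \<tau> / \<tau>\<close> is nondecreasing in \<open>\<tau>\<close>, and its limit at \<open>0\<close> is decided
  along one sequence.\<close>

lemma rho_mod_scale_le: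
  assumes F: "F \<in> Subl" and "0 \<le> \<tau>" "0 < s" "s \<le> 1"
  shows "rho_mod F (s * \<tau>) \<le> s * rho_mod F \<tau>"
proof (cases "F = {0}")
  case False
  have s\<tau>: "0 \<le> s * \<tau>" using assms by simp
  show ?thesis
  proof (rule ccontr)
    assume "\<not> ?thesis"
    then have "s * rho_mod F \<tau> < rho_mod F (s * \<tau>)" by simp
    then obtain x y where xy: "x \<in> F" "y \<in> F" "0 \<le> x" "0 \<le> y" "norm x = 1" "norm y = 1"
        and less: "s * rho_mod F \<tau> < norm (sup x ((s * \<tau>) *\<^sub>R y)) - 1"
      unfolding less_rho_mod_iff[OF F False s\<tau>] by blast
    define z where "z = sup x (\<tau> *\<^sub>R y)"
    have "norm z - 1 \<le> rho_mod F \<tau>"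
      using less_rho_mod_iff[OF F False assms(2), of "rho_mod F \<tau>"] xy unfolding z_def
      by (meson less_irrefl not_le)
    \<comment> \<open>Convexity: the right-hand side dominates both arguments of the supremum.\<close>
    have "sup x ((s * \<tau>) *\<^sub>R y) \<le> s *\<^sub>R z + (1 - s) *\<^sub>R x"
    proof (rule sup_least)
      have "s *\<^sub>R x + (1 - s) *\<^sub>R x \<le> s *\<^sub>R z + (1 - s) *\<^sub>R x"
        using assms by (intro add_right_mono scaleR_left_mono) (auto simp: z_def)
      then show "x \<le> s *\<^sub>R z + (1 - s) *\<^sub>R x" by (simp flip: scaleR_left_distrib)
      have "s *\<^sub>R (\<tau> *\<^sub>R y) + 0 \<le> s *\<^sub>R z + (1 - s) *\<^sub>R x"
        using assms xy by (intro add_mono scaleR_left_mono scaleR_nonneg_nonneg) (auto simp: z_def)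
      then show "(s * \<tau>) *\<^sub>R y \<le> s *\<^sub>R z + (1 - s) *\<^sub>R x" by simp
    qed
    moreover have "0 \<le> sup x ((s * \<tau>) *\<^sub>R y)" using xy(3) by (simp add: le_supI1)
    ultimately have "norm (sup x ((s * \<tau>) *\<^sub>R y)) \<le> norm (s *\<^sub>R z + (1 - s) *\<^sub>R x)"
      using norm_mono_nonneg by blast
    also have "\<dots> \<le> s * norm z + (1 - s)"
      using norm_triangle_ineq[of "s *\<^sub>R z" "(1 - s) *\<^sub>R x"] assms xy by simp
    finally have "norm (sup x ((s * \<tau>) *\<^sub>R y)) - 1 \<le> s * (norm z - 1)" by (simp add: algebra_simps)
    also have "\<dots> \<le> s * rho_mod F \<tau>" using \<open>norm z - 1 \<le> _\<close> assms by simp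
    finally show False using less by simp
  qed
qed (simp add: rho_mod_def)

lemma order_uniformly_smooth_iff_rho_mod:
  assumes F: "F \<in> Subl"
  shows "order_uniformly_smooth F \<longleftrightarrow>
    (\<forall>k. \<exists>m. rho_mod F (1 / real (Suc m)) < 1 / (real (Suc m) * real (Suc k)))"
proof
  assume "order_uniformly_smooth F"
  then have lim: "((\<lambda>\<tau>. rho_mod F \<tau> / \<tau>) \<longlongrightarrow> 0) (at_right 0)"
    by (simp add: order_uniformly_smooth_def)
  have "filterlim (\<lambda>m. 1 / real (Suc m)) (at_right 0) sequentially"
    unfolding filterlim_at using LIMSEQ_Suc[OF lim_1_over_n] by (auto simp del: of_nat_Suc)
  then have lim': "(\<lambda>m. rho_mod F (1 / real (Suc m)) / (1 / real (Suc m))) \<longlonglongrightarrow> 0"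
    by (rule filterlim_compose[OF lim])
  show "\<forall>k. \<exists>m. rho_mod F (1 / real (Suc m)) < 1 / (real (Suc m) * real (Suc k))"
  proof
    fix k
    have "\<forall>\<^sub>F m in sequentially. rho_mod F (1 / real (Suc m)) / (1 / real (Suc m)) < 1 / real (Suc k)"
      by (rule order_tendstoD(2)[OF lim']) simp
    then obtain m where "rho_mod F (1 / real (Suc m)) / (1 / real (Suc m)) < 1 / real (Suc k)"
      by (meson eventually_happens' sequentially_bot)
    then show "\<exists>m. rho_mod F (1 / real (Suc m)) < 1 / (real (Suc m) * real (Suc k))"
      by (intro exI[of _ m]) (simp add: field_simps del: of_nat_Suc)
  qed
next
  assume R: "\<forall>k. \<exists>m. rho_mod F (1 / real (Suc m)) < 1 / (real (Suc m) * real (Suc k))"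
  show "order_uniformly_smooth F"
    unfolding order_uniformly_smooth_def
  proof (rule tendstoI)
    fix e :: real assume "e > 0"
    then obtain k where k: "1 / real (Suc k) < e" using nat_approx_posE by blast
    obtain m where m: "rho_mod F (1 / real (Suc m)) < 1 / (real (Suc m) * real (Suc k))"
      using R by blast
    define b where "b = 1 / real (Suc m)"
    have b0: "b > 0" by (simp add: b_def)
    have "rho_mod F b < b * (1 / real (Suc k))" using m by (simp add: b_def del: of_nat_Suc)
    also have "\<dots> < b * e" using k b0 by (intro mult_strict_left_mono)
    finally have be: "rho_mod F b < b * e" .
    have "dist (rho_mod F \<tau> / \<tau>) 0 < e" if "0 < \<tau>" "\<tau> < b" for \<tau>
    proof -
      have "rho_mod F \<tau> = rho_mod F ((\<tau> / b) * b)" using b0 by simp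
      also have "\<dots> \<le> (\<tau> / b) * rho_mod F b"
        using that b0 by (intro rho_mod_scale_le[OF F]) auto
      also have "\<dots> < (\<tau> / b) * (b * e)" using be that b0 by (intro mult_strict_left_mono) auto
      also have "\<dots> = \<tau> * e" using b0 by simp
      finally have "rho_mod F \<tau> / \<tau> < e" using that by (simp add: divide_less_eq mult.commute)
      then show ?thesis using rho_mod_nonneg[OF F, of \<tau>] that by simp
    qed
    then show "\<forall>\<^sub>F \<tau> in at_right 0. dist (rho_mod F \<tau> / \<tau>) 0 < e"
      unfolding eventually_at_right_field using b0 by blast
  qed
qed

section \<open>Countable unions and intersections\<close>

lemma fsigma_in_UN:
  assumes "countable I" "\<And>i. i \<in> I \<Longrightarrow> fsigma_in X (A i)"
  shows "fsigma_in X (\<Union>i\<in>I. A i)"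
  using assms by (intro fsigma_in_Union) auto

lemma Pi03_in_INT:
  assumes "\<And>n :: nat. fsigma_in X (A n)"
  shows "Pi03_in X (\<Inter>n. A n)"
proof -
  have "(countable intersection_of fsigma_in X) (\<Inter>n. A n)"
    unfolding intersection_of_def using assms by (intro exI[of _ "range A"]) auto
  moreover have "topspace X \<inter> (\<Inter>n. A n) = (\<Inter>n. A n)"
    using fsigma_in_subset[OF assms] by blast
  ultimately show ?thesis
    unfolding Pi03_in_def relative_to_def by metis
qed

lemma open_real_rational_intervals:
  assumes "open (U :: real set)"
  obtains I where "countable I" "\<And>x. x \<in> U \<longleftrightarrow> (\<exists>p\<in>I. fst p < x \<and> x < snd p)"
proof
  let ?I = "{p \<in> \<rat> \<times> \<rat>. {fst p<..<snd p} \<subseteq> U}"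
  show "countable ?I"
    by (rule countable_subset[of _ "\<rat> \<times> \<rat>"]) (auto simp: countable_rat)
  show "x \<in> U \<longleftrightarrow> (\<exists>p\<in>?I. fst p < x \<and> x < snd p)" for x
  proof
    assume "x \<in> U"
    then obtain e where e: "e > 0" "\<And>y. \<bar>y - x\<bar> < e \<Longrightarrow> y \<in> U"
      using assms by (auto simp: open_real)
    obtain a where a: "a \<in> \<rat>" "x - e < a" "a < x" using Rats_dense_in_real[of "x - e" x] e by auto
    obtain b where b: "b \<in> \<rat>" "x < b" "b < x + e" using Rats_dense_in_real[of x "x + e"] e by auto
    have "{a<..<b} \<subseteq> U" using a b by (auto intro!: e(2))
    then show "\<exists>p\<in>?I. fst p < x \<and> x < snd p"
      using a b by (intro bexI[of _ "(a, b)"]) auto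
  qed auto
qed

lemma Baire_class_1_uminus:
  assumes "Baire_class_1 X (\<lambda>F. - f F)"
  shows "Baire_class_1 X f"
  unfolding Baire_class_1_def
proof (intro allI impI)
  fix U :: "real set" assume "open U"
  then have "fsigma_in X {x \<in> topspace X. - f x \<in> uminus ` U}"
    using assms open_negations[of U] by (simp add: Baire_class_1_def)
  moreover have "- f x \<in> uminus ` U \<longleftrightarrow> f x \<in> U" for x by force
  ultimately show "fsigma_in X {x \<in> topspace X. f x \<in> U}" by simp
qed

section \<open>Hit sets in the Wijsman topology\<close>

text \<open>The metric \<open>d\<close> that defines the Wijsman topology need not be the one given by the norm; the two are
  only assumed to have the same open sets.\<close>

locale Wijsman_sublattices = Metric_space "UNIV :: 'a::banach_lattice set" d for d +
  assumes separable: "separable_space (euclidean :: 'a topology)"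
    and compatible: "mtopology = (euclidean :: 'a topology)"
begin

abbreviation setd :: "'a \<Rightarrow> 'a set \<Rightarrow> real" where
  "setd x F \<equiv> (INF y\<in>F. d x y)"

text \<open>Pairs are tested because each of the conditions behind the moduli involves two vectors.\<close>

definition hits :: "('a \<times> 'a) set \<Rightarrow> 'a set set" where
  "hits W = {F \<in> Subl. \<exists>x\<in>F. \<exists>y\<in>F. (x, y) \<in> W}"

lemma hits_subset: "hits W \<subseteq> Subl"
  by (auto simp: hits_def)

lemma topspace_Subl [simp]: "topspace (Subl_topology d) = Subl"
proof -
  have "F \<in> \<Union>{{F. closed F \<and> F \<noteq> {} \<and> setd x F \<in> U} | x U. open U}" if "F \<in> Subl" for F
    using SublD[OF that] by (auto intro!: exI[of _ "UNIV :: real set"])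
  then show ?thesis
    unfolding Subl_topology_def Wijsman_topology_def topspace_subtopology topology_generated_by_topspace
    by blast
qed

lemma openin_setd:
  assumes "open U"
  shows "openin (Subl_topology d) {F \<in> Subl. setd x F \<in> U}"
proof -
  have "openin (Wijsman_topology d) {F. closed F \<and> F \<noteq> {} \<and> setd x F \<in> U}"
    unfolding Wijsman_topology_def using assms by (intro topology_generated_by_Basis) blast
  moreover have "{F \<in> Subl. setd x F \<in> U} = {F. closed F \<and> F \<noteq> {} \<and> setd x F \<in> U} \<inter> Subl"
    using SublD(1,4) by blast
  ultimately show ?thesis unfolding Subl_topology_def openin_subtopology by blast
qed

lemma closedin_setd:
  assumes "closed U"
  shows "closedin (Subl_topology d) {F \<in> Subl. setd x F \<in> U}"
proof -
  have "Subl - {F \<in> Subl. setd x F \<in> U} = {F \<in> Subl. setd x F \<in> - U}" by auto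
  then show ?thesis using openin_setd[OF open_Compl[OF assms], of x]
    unfolding closedin_def topspace_Subl by auto
qed

lemma setd_less_iff:
  assumes "F \<in> Subl"
  shows "setd x F < r \<longleftrightarrow> (\<exists>y\<in>F. d x y < r)"
  using SublD(4)[OF assms] by (intro cINF_less_iff bdd_belowI[of _ 0]) auto

lemma fsigma_in_setd_less: "fsigma_in (Subl_topology d) {F \<in> Subl. setd x F < r}"
proof -
  have "setd x F < r \<longleftrightarrow> (\<exists>n. setd x F \<le> r - 1 / real (Suc n))" for F
  proof
    assume "setd x F < r"
    then obtain n where "1 / real (Suc n) < r - setd x F"
      using nat_approx_posE[of "r - setd x F"] by auto
    then show "\<exists>n. setd x F \<le> r - 1 / real (Suc n)" by (intro exI[of _ n]) linarith
  next
    assume "\<exists>n. setd x F \<le> r - 1 / real (Suc n)"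
    then obtain n where "setd x F \<le> r - 1 / real (Suc n)" ..
    moreover have "1 / real (Suc n) > 0" by simp
    ultimately show "setd x F < r" by linarith
  qed
  then have "{F \<in> Subl. setd x F < r} = (\<Union>n. {F \<in> Subl. setd x F \<in> {..r - 1 / real (Suc n)}})"
    by auto
  moreover have "fsigma_in (Subl_topology d) (\<Union>n. {F \<in> Subl. setd x F \<in> {..r - 1 / real (Suc n)}})"
    by (intro fsigma_in_UN closed_imp_fsigma_in closedin_setd) auto
  ultimately show ?thesis by metis
qed

lemma open_contains_mball:
  assumes "open A" "x \<in> A"
  obtains e where "e > 0" "mball x e \<subseteq> A"
  using assms openin_mtopology[of A] by (auto simp: compatible)

lemma open_mball: "open (mball x r)"
  using openin_mball[of x r] by (simp add: compatible)

lemma countable_dense: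
  obtains D :: "'a set" where "countable D" "closure D = UNIV"
  using separable by (auto simp: separable_space_def)

text \<open>Balls with rational radii about the points of a dense set form a base; in a separable space this base
  can be taken countable.\<close>

lemma mball_rational_approx:
  assumes D: "closure D = UNIV" and A: "open A" "x \<in> A"
  obtains a r where "a \<in> D" "r \<in> \<rat>" "d a x < r" "mball a r \<subseteq> A"
proof -
  obtain e where e: "e > 0" "mball x e \<subseteq> A" using open_contains_mball A by blast
  have "x \<in> closure D" using D by simp
  moreover have "x \<in> mball x (e/2)" using e by simp
  ultimately obtain a where a: "a \<in> D" "a \<in> mball x (e/2)"
    using open_mball[of x "e/2"] by (metis closure_iff_nhds_not_empty order_refl disjoint_iff)
  then have "d a x < e/2" by (simp add: commute)
  then obtain r where r: "r \<in> \<rat>" "d a x < r" "r < e/2"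
    using Rats_dense_in_real[of "d a x" "e/2"] by auto
  have "mball a r \<subseteq> A"
  proof
    fix z assume "z \<in> mball a r"
    then have "d x z < e" using r triangle[of x a z] commute[of x a] by auto
    then show "z \<in> A" using e by auto
  qed
  then show ?thesis using that a r by blast
qed

text \<open>The open set \<open>W\<close> is a countable union of products of balls, and a sublattice meets the ball of radius
  \<open>r\<close> about \<open>a\<close> exactly if its distance from \<open>a\<close> is below \<open>r\<close>.\<close>

lemma hits_eq_countable_Union:
  assumes "open W"
  obtains I where "countable I"
    "hits W = (\<Union>(a, b, r, s) \<in> I. {F \<in> Subl. setd a F < r} \<inter> {F \<in> Subl. setd b F < s})"
proof -
  obtain D :: "'a set" where D: "countable D" "closure D = UNIV" using countable_dense .
  define I where "I = {(a, b, r, s). a \<in> D \<and> b \<in> D \<and> r \<in> \<rat> \<and> s \<in> \<rat> \<and> mball a r \<times> mball b s \<subseteq> W}"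
  have "countable (D \<times> D \<times> (\<rat> :: real set) \<times> (\<rat> :: real set))"
    using D by (intro countable_SIGMA) (auto simp: countable_rat)
  then have "countable I" by (rule countable_subset[rotated]) (auto simp: I_def)
  moreover have "hits W = (\<Union>(a, b, r, s) \<in> I. {F \<in> Subl. setd a F < r} \<inter> {F \<in> Subl. setd b F < s})"
    (is "_ = ?R")
  proof (intro antisym subsetI)
    fix F assume "F \<in> hits W"
    then obtain x y where F: "F \<in> Subl" "x \<in> F" "y \<in> F" "(x, y) \<in> W" by (auto simp: hits_def)
    then obtain A B where AB: "open A" "open B" "x \<in> A" "y \<in> B" "A \<times> B \<subseteq> W"
      using open_prod_elim[OF assms] by (metis mem_Sigma_iff)
    obtain a r where ar: "a \<in> D" "r \<in> \<rat>" "d a x < r" "mball a r \<subseteq> A"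
      using mball_rational_approx[OF D(2) AB(1,3)] .
    obtain b s where bs: "b \<in> D" "s \<in> \<rat>" "d b y < s" "mball b s \<subseteq> B"
      using mball_rational_approx[OF D(2) AB(2,4)] .
    have "(a, b, r, s) \<in> I" using ar bs AB unfolding I_def by blast
    moreover have "setd a F < r" "setd b F < s"
      using ar bs F setd_less_iff[OF F(1)] by auto
    ultimately show "F \<in> ?R" using F(1) by blast
  next
    fix F assume "F \<in> ?R"
    then obtain a b r s where abrs: "(a, b, r, s) \<in> I" "F \<in> Subl" "setd a F < r" "setd b F < s" by blast
    then obtain x y where "x \<in> F" "y \<in> F" "x \<in> mball a r" "y \<in> mball b s"
      using setd_less_iff[OF abrs(2)] by auto
    then show "F \<in> hits W" using abrs unfolding hits_def I_def by blast
  qed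
  ultimately show ?thesis using that by blast
qed

lemma openin_hits:
  assumes "open W"
  shows "openin (Subl_topology d) (hits W)"
proof -
  obtain I where "countable I"
    and I: "hits W = (\<Union>(a, b, r, s) \<in> I. {F \<in> Subl. setd a F < r} \<inter> {F \<in> Subl. setd b F < s})"
    using hits_eq_countable_Union[OF assms] .
  have "openin (Subl_topology d) {F \<in> Subl. setd a F < r}" for a r
    using openin_setd[of "{..<r}" a] by simp
  then show ?thesis unfolding I case_prod_beta by (intro openin_Union) auto
qed

lemma fsigma_in_hits:
  assumes "open W"
  shows "fsigma_in (Subl_topology d) (hits W)"
proof -
  obtain I where I: "countable I"
    "hits W = (\<Union>(a, b, r, s) \<in> I. {F \<in> Subl. setd a F < r} \<inter> {F \<in> Subl. setd b F < s})"
    using hits_eq_countable_Union[OF assms] .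
  show ?thesis
    unfolding I(2) case_prod_beta by (intro fsigma_in_UN fsigma_in_Int fsigma_in_setd_less I(1))
qed

lemma closedin_Compl_hits:
  assumes "open W"
  shows "closedin (Subl_topology d) (Subl - hits W)"
  using openin_closedin_eq[of "Subl_topology d" "hits W"] openin_hits[OF assms] by simp

lemma nontrivial_eq_hits: "{F \<in> Subl. F \<noteq> {0}} = hits {z. fst z \<noteq> 0}"
  unfolding hits_def using Subl_nontrivial by auto

lemma open_nonzero_fst: "open {z :: 'a \<times> 'a. fst z \<noteq> 0}"
  by (intro open_Collect_neq continuous_intros)

lemma closedin_zero: "closedin (Subl_topology d) {{0}}"
proof -
  have "{{0}} = Subl - hits {z. fst z \<noteq> 0}"
    using zero_in_Subl by (auto simp flip: nontrivial_eq_hits)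
  then show ?thesis using closedin_Compl_hits[OF open_nonzero_fst] by simp
qed

text \<open>On the nonzero sublattices, which form a hit set themselves, the condition \<open>f F < r\<close> defines a hit set, which is
  open and \<open>F\<^sub>\<sigma>\<close>; so \<open>a < f F\<close> defines the union of the relatively closed sets \<open>a + 1/n \<le> f F\<close>. The zero lattice is a closed
  point, so the value of \<open>f\<close> there can be arbitrary.\<close>

lemma Baire_class_1_if_less_iff_hits:
  assumes W: "\<And>r. open (W r)"
    and f: "\<And>F r. F \<in> Subl \<Longrightarrow> F \<noteq> {0} \<Longrightarrow> f F < r \<longleftrightarrow> F \<in> hits (W r)"
  shows "Baire_class_1 (Subl_topology d) f"
proof -
  have zero: "fsigma_in (Subl_topology d) {F. F = {0} \<and> P}" for P
  proof (cases P)
    case True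
    then have "{F. F = {0} \<and> P} = {{0 :: 'a}}" by auto
    then show ?thesis using closed_imp_fsigma_in[OF closedin_zero] by simp
  qed simp
  have nontrivial: "fsigma_in (Subl_topology d) {F \<in> Subl. F \<noteq> {0}}"
    unfolding nontrivial_eq_hits by (rule fsigma_in_hits[OF open_nonzero_fst])
  have less: "fsigma_in (Subl_topology d) {F \<in> Subl. f F < b}" for b
  proof -
    have eq: "{F \<in> Subl. f F < b} =
        ({F \<in> Subl. F \<noteq> {0}} \<inter> hits (W b)) \<union> {F. F = {0} \<and> f {0} < b}"
      using f zero_in_Subl hits_subset by blast
    show ?thesis
      unfolding eq by (intro fsigma_in_Un fsigma_in_Int nontrivial zero fsigma_in_hits W)
  qed
  have greater: "fsigma_in (Subl_topology d) {F \<in> Subl. a < f F}" for a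
  proof -
    have iff: "a < f F \<longleftrightarrow> (\<exists>n. F \<notin> hits (W (a + 1 / real (Suc n))))"
      if F: "F \<in> Subl" "F \<noteq> {0}" for F
    proof
      assume "a < f F"
      then obtain n where "1 / real (Suc n) < f F - a" using nat_approx_posE[of "f F - a"] by auto
      then have "\<not> f F < a + 1 / real (Suc n)" by linarith
      then show "\<exists>n. F \<notin> hits (W (a + 1 / real (Suc n)))" using f[OF F] by blast
    next
      assume "\<exists>n. F \<notin> hits (W (a + 1 / real (Suc n)))"
      then obtain n where "\<not> f F < a + 1 / real (Suc n)" using f[OF F] by blast
      moreover have "1 / real (Suc n) > 0" by simp
      ultimately show "a < f F" by linarith
    qed
    have eq: "{F \<in> Subl. a < f F} =
        ({F \<in> Subl. F \<noteq> {0}} \<inter> (\<Union>n. Subl - hits (W (a + 1 / real (Suc n)))))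
        \<union> {F. F = {0} \<and> a < f {0}}" (is "?L = ?R")
    proof (rule set_eqI)
      fix F show "F \<in> ?L \<longleftrightarrow> F \<in> ?R"
      proof (cases "F \<in> Subl \<and> F \<noteq> {0}")
        case True
        then show ?thesis using iff[of F] by simp
      next
        case False
        then show ?thesis using zero_in_Subl by auto
      qed
    qed
    have "fsigma_in (Subl_topology d) (\<Union>n. Subl - hits (W (a + 1 / real (Suc n))))"
      by (intro fsigma_in_UN closed_imp_fsigma_in closedin_Compl_hits W) auto
    then show ?thesis
      unfolding eq by (intro fsigma_in_Un fsigma_in_Int nontrivial zero)
  qed
  show ?thesis
    unfolding Baire_class_1_def
  proof (intro allI impI)
    fix U :: "real set" assume "open U"
    then obtain I where I: "countable I" "\<And>x. x \<in> U \<longleftrightarrow> (\<exists>p\<in>I. fst p < x \<and> x < snd p)"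
      using open_real_rational_intervals by metis
    have "{F \<in> topspace (Subl_topology d). f F \<in> U}
        = (\<Union>p\<in>I. {F \<in> Subl. fst p < f F} \<inter> {F \<in> Subl. f F < snd p})"
      unfolding I(2) by auto
    moreover have "fsigma_in (Subl_topology d) \<dots>"
      by (intro fsigma_in_UN fsigma_in_Int less greater I(1))
    ultimately show "fsigma_in (Subl_topology d) {F \<in> topspace (Subl_topology d). f F \<in> U}"
      by simp
  qed
qed

section \<open>Borel complexity of the moduli\<close>

lemma Baire_class_1_sigma_mod:
  assumes "0 < \<epsilon>" "\<epsilon> \<le> 1"
  shows "Baire_class_1 (Subl_topology d) (\<lambda>F. sigma_mod F \<epsilon>)"
proof (rule Baire_class_1_if_less_iff_hits)
  show "open {z :: 'a \<times> 'a. \<epsilon> * norm (fst z) < norm (snd z) \<and>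
      norm (\<bar>fst z\<bar> + \<bar>snd z\<bar>) < (1 + r) * norm (fst z)}" for r
    by (intro open_Collect_conj open_Collect_less continuous_intros continuous_on_abs_lattice)
next
  fix F r assume F: "F \<in> Subl" "F \<noteq> {0 :: 'a}"
  show "sigma_mod F \<epsilon> < r \<longleftrightarrow> F \<in> hits {z. \<epsilon> * norm (fst z) < norm (snd z) \<and>
      norm (\<bar>fst z\<bar> + \<bar>snd z\<bar>) < (1 + r) * norm (fst z)}"
    unfolding sigma_mod_less_iff_homogeneous[OF F assms] hits_def using F(1) by simp
qed

lemma Baire_class_1_rho_mod:
  assumes "0 \<le> \<tau>"
  shows "Baire_class_1 (Subl_topology d) (\<lambda>F. rho_mod F \<tau>)"
proof (rule Baire_class_1_uminus, rule Baire_class_1_if_less_iff_hits)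
  show "open {z :: 'a \<times> 'a. (1 + - r) * norm (fst z) * norm (snd z) < norm (sup
      (norm (snd z) *\<^sub>R \<bar>fst z\<bar>) ((\<tau> * norm (fst z)) *\<^sub>R \<bar>snd z\<bar>))}" for r
    by (intro open_Collect_less continuous_intros continuous_on_abs_lattice continuous_on_sup_lattice)
next
  fix F r assume F: "F \<in> Subl" "F \<noteq> {0 :: 'a}"
  have "- rho_mod F \<tau> < r \<longleftrightarrow> - r < rho_mod F \<tau>" by linarith
  then show "- rho_mod F \<tau> < r \<longleftrightarrow> F \<in> hits {z. (1 + - r) * norm (fst z) * norm (snd z) < norm (sup
      (norm (snd z) *\<^sub>R \<bar>fst z\<bar>) ((\<tau> * norm (fst z)) *\<^sub>R \<bar>snd z\<bar>))}"
    unfolding less_rho_mod_iff_homogeneous[OF F assms] hits_def using F(1) by simp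
qed

lemma fsigma_in_sigma_mod_pos:
  assumes "0 < \<epsilon>" "\<epsilon> \<le> 1"
  shows "fsigma_in (Subl_topology d) {F \<in> Subl. sigma_mod F \<epsilon> > 0}"
proof -
  have "fsigma_in (Subl_topology d) {F \<in> topspace (Subl_topology d). sigma_mod F \<epsilon> \<in> {0<..}}"
    using Baire_class_1_sigma_mod[OF assms] open_greaterThan unfolding Baire_class_1_def by blast
  then show ?thesis by simp
qed

lemma fsigma_in_rho_mod_less:
  assumes "0 \<le> \<tau>"
  shows "fsigma_in (Subl_topology d) {F \<in> Subl. rho_mod F \<tau> < r}"
proof -
  have "fsigma_in (Subl_topology d) {F \<in> topspace (Subl_topology d). rho_mod F \<tau> \<in> {..<r}}"
    using Baire_class_1_rho_mod[OF assms] open_lessThan unfolding Baire_class_1_def by blast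
  then show ?thesis by simp
qed

lemma Pi03_in_uniformly_monotone:
  "Pi03_in (Subl_topology d) {F \<in> Subl. uniformly_monotone F}"
proof -
  have eq: "{F \<in> Subl. uniformly_monotone F} = (\<Inter>n. {F \<in> Subl. sigma_mod F (1 / real (Suc n)) > 0})"
    using uniformly_monotone_iff_sigma_mod by blast
  show ?thesis
    unfolding eq by (intro Pi03_in_INT fsigma_in_sigma_mod_pos) (auto simp: divide_le_eq)
qed

lemma Pi03_in_order_uniformly_smooth:
  "Pi03_in (Subl_topology d) {F \<in> Subl. order_uniformly_smooth F}"
proof -
  have eq: "{F \<in> Subl. order_uniformly_smooth F} = (\<Inter>k. \<Union>m.
      {F \<in> Subl. rho_mod F (1 / real (Suc m)) < 1 / (real (Suc m) * real (Suc k))})"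
    (is "?L = ?R")
  proof (rule set_eqI)
    show "F \<in> ?L \<longleftrightarrow> F \<in> ?R" for F
      using order_uniformly_smooth_iff_rho_mod[of F] by (cases "F \<in> Subl") simp_all
  qed
  show ?thesis
    unfolding eq by (intro Pi03_in_INT fsigma_in_UN fsigma_in_rho_mod_less) auto
qed

end

section \<open>Continuous surjections from the Baire space\<close>

text \<open>A sequence of indices is read as a sequence of proposed points \<open>q (\<alpha> k)\<close>; a proposal is accepted only if it is
  within \<open>(1/2) ^ k\<close> of the current point. Every sequence of indices thus yields a Cauchy sequence, with a
  rate that does not depend on \<open>\<alpha>\<close>.\<close>

primrec guided_approx :: "(nat \<Rightarrow> 'b::metric_space) \<Rightarrow> nat \<Rightarrow> (nat \<Rightarrow> nat) \<Rightarrow> 'b" where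
  "guided_approx q 0 \<alpha> = q (\<alpha> 0)"
| "guided_approx q (Suc k) \<alpha> =
    (if dist (q (\<alpha> (Suc k))) (guided_approx q k \<alpha>) \<le> (1/2) ^ k
     then q (\<alpha> (Suc k)) else guided_approx q k \<alpha>)"

lemma open_coordinate_eq: "open {\<alpha> :: nat \<Rightarrow> nat. \<alpha> k = n}"
proof -
  have "open ((\<lambda>\<alpha> :: nat \<Rightarrow> nat. \<alpha> k) -` {n})"
    by (intro open_vimage continuous_on_product_coordinates) (simp add: open_discrete)
  then show ?thesis by (simp add: vimage_def)
qed

text \<open>The \<open>k\<close>-th approximation depends only on the first \<open>k + 1\<close> indices, so it is locally constant.
  The preimage of an arbitrary set is considered because the induction step needs preimages of points.\<close>

lemma open_vimage_guided_approx: "open (guided_approx q k -` A)"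
proof (induction k arbitrary: A)
  case 0
  have eq: "guided_approx q 0 -` A = (\<Union>n \<in> {n. q n \<in> A}. {\<alpha>. \<alpha> 0 = n})" by auto
  show ?case unfolding eq by (intro open_UN ballI open_coordinate_eq)
next
  case (Suc k)
  let ?g = "\<lambda>n c. if dist (q n) c \<le> (1/2) ^ k then q n else c"
  have eq: "guided_approx q (Suc k) -` A =
      (\<Union>n. \<Union>c \<in> {c. ?g n c \<in> A}. {\<alpha>. \<alpha> (Suc k) = n} \<inter> guided_approx q k -` {c})"
    by (auto simp: vimage_def)
  show ?case
    unfolding eq by (intro open_UN ballI open_Int open_coordinate_eq Suc.IH)
qed

lemma dist_guided_approx:
  "dist (guided_approx q (m + j) \<alpha>) (guided_approx q m \<alpha>) \<le> 2 * (1/2) ^ m - 2 * (1/2) ^ (m + j)"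
proof (induction j)
  case (Suc j)
  have "dist (guided_approx q (m + Suc j) \<alpha>) (guided_approx q (m + j) \<alpha>) \<le> (1/2) ^ (m + j)"
    by simp
  then show ?case
    using Suc dist_triangle[of "guided_approx q (m + Suc j) \<alpha>" "guided_approx q m \<alpha>" "guided_approx q (m + j) \<alpha>"]
    by simp
qed simp

lemma guided_approx_limit:
  fixes q :: "nat \<Rightarrow> 'b::complete_space"
  obtains l where "\<And>\<alpha>. (\<lambda>k. guided_approx q k \<alpha>) \<longlonglongrightarrow> l \<alpha>"
    "\<And>m \<alpha>. dist (guided_approx q m \<alpha>) (l \<alpha>) \<le> 2 * (1/2) ^ m"
proof -
  have bound: "dist (guided_approx q n \<alpha>) (guided_approx q m \<alpha>) \<le> 2 * (1/2) ^ m" if "m \<le> n" for m n \<alpha>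
  proof -
    have "dist (guided_approx q n \<alpha>) (guided_approx q m \<alpha>) \<le> 2 * (1/2) ^ m - 2 * (1/2) ^ n"
      using dist_guided_approx[of q m "n - m" \<alpha>] that by simp
    moreover have "0 \<le> 2 * (1/2 :: real) ^ n" by simp
    ultimately show ?thesis by linarith
  qed
  have pow: "(\<lambda>m. 2 * (1/2 :: real) ^ m) \<longlonglongrightarrow> 0"
    by (intro tendsto_mult_right_zero LIMSEQ_power_zero) simp
  have "convergent (\<lambda>k. guided_approx q k \<alpha>)" for \<alpha>
  proof -
    have "Cauchy (\<lambda>k. guided_approx q k \<alpha>)"
    proof (rule CauchyI')
      fix e :: real assume "e > 0"
      then obtain M where M: "\<And>m. m \<ge> M \<Longrightarrow> 2 * (1/2 :: real) ^ m < e"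
        using order_tendstoD(2)[OF pow] by (auto simp: eventually_sequentially)
      show "\<exists>M. \<forall>m\<ge>M. \<forall>n>m. dist (guided_approx q m \<alpha>) (guided_approx q n \<alpha>) < e"
      proof (intro exI[of _ M] allI impI)
        fix m n assume "M \<le> m" "m < n"
        then have "dist (guided_approx q m \<alpha>) (guided_approx q n \<alpha>) \<le> 2 * (1/2) ^ m"
          using bound[of m n \<alpha>] by (simp add: dist_commute)
        also have "\<dots> < e" using M[OF \<open>M \<le> m\<close>] .
        finally show "dist (guided_approx q m \<alpha>) (guided_approx q n \<alpha>) < e" .
      qed
    qed
    then show ?thesis by (simp add: Cauchy_convergent_iff)
  qed
  then obtain l where l: "\<And>\<alpha>. (\<lambda>k. guided_approx q k \<alpha>) \<longlonglongrightarrow> l \<alpha>"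
    unfolding convergent_def by metis
  have "dist (guided_approx q m \<alpha>) (l \<alpha>) \<le> 2 * (1/2) ^ m" for m \<alpha>
  proof -
    have "(\<lambda>n. dist (guided_approx q m \<alpha>) (guided_approx q n \<alpha>)) \<longlonglongrightarrow> dist (guided_approx q m \<alpha>) (l \<alpha>)"
      by (intro tendsto_intros l)
    then show ?thesis
    proof (rule LIMSEQ_le_const2, intro exI[of _ m] allI impI)
      show "dist (guided_approx q m \<alpha>) (guided_approx q n \<alpha>) \<le> 2 * (1/2) ^ m" if "m \<le> n" for n
        using bound[OF that] by (simp add: dist_commute)
    qed
  qed
  then show ?thesis using that l by blast
qed

text \<open>The limit of the guided approximations is continuous in \<open>\<alpha>\<close> as a uniform limit of continuous functions.
  It takes every value \<open>x\<close>: if the \<open>k\<close>-th proposal is within \<open>(1/2) ^ (k + 2)\<close> of \<open>x\<close>, then consecutive proposals are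
  so close that all of them are accepted.\<close>

lemma Baire_space_continuous_surjection:
  fixes D :: "'b::complete_space set"
  assumes "countable D" "closure D = UNIV"
  obtains p :: "(nat \<Rightarrow> nat) \<Rightarrow> 'b" where "continuous_on UNIV p" "surj p"
proof -
  have "D \<noteq> {}" using assms(2) by auto
  define q where "q = from_nat_into D"
  have q: "range q = D" unfolding q_def using \<open>D \<noteq> {}\<close> assms(1) by (rule range_from_nat_into)
  obtain p where p: "\<And>\<alpha>. (\<lambda>k. guided_approx q k \<alpha>) \<longlonglongrightarrow> p \<alpha>"
    "\<And>m \<alpha>. dist (guided_approx q m \<alpha>) (p \<alpha>) \<le> 2 * (1/2) ^ m"
    using guided_approx_limit by blast
  have "continuous_on UNIV p"
  proof (rule uniform_limit_theorem)
    have "continuous_on UNIV (guided_approx q k)" for k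
      using open_vimage_guided_approx by (auto simp: continuous_on_open_vimage)
    then show "\<forall>\<^sub>F k in sequentially. continuous_on UNIV (guided_approx q k)" by simp
    show "uniform_limit UNIV (guided_approx q) p sequentially"
    proof (rule uniform_limitI)
      fix e :: real assume "e > 0"
      have "(\<lambda>m. 2 * (1/2 :: real) ^ m) \<longlonglongrightarrow> 0"
        by (intro tendsto_mult_right_zero LIMSEQ_power_zero) simp
      then have "\<forall>\<^sub>F m in sequentially. 2 * (1/2 :: real) ^ m < e"
        using \<open>e > 0\<close> by (rule order_tendstoD(2))
      then show "\<forall>\<^sub>F m in sequentially. \<forall>\<alpha>\<in>UNIV. dist (guided_approx q m \<alpha>) (p \<alpha>) < e"
        by eventually_elim (use p(2) le_less_trans in blast)
    qed
  qed simp
  moreover have "\<exists>\<alpha>. p \<alpha> = x" for x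
  proof -
    have "\<exists>n. dist (q n) x < (1/2) ^ (k + 2)" for k
    proof -
      have "x \<in> closure D" "(1/2 :: real) ^ (k + 2) > 0" using assms(2) by auto
      then obtain a where "a \<in> D" "dist a x < (1/2) ^ (k + 2)" unfolding closure_approachable by blast
      then show ?thesis using q by blast
    qed
    then obtain \<alpha> where \<alpha>: "\<And>k. dist (q (\<alpha> k)) x < (1/2) ^ (k + 2)" by metis
    have approx: "guided_approx q k \<alpha> = q (\<alpha> k)" for k
    proof (induction k)
      case (Suc k)
      have "dist (q (\<alpha> (Suc k))) (q (\<alpha> k)) \<le> (1/2) ^ (Suc k + 2) + (1/2) ^ (k + 2)"
        using \<alpha>[of k] \<alpha>[of "Suc k"] dist_triangle2[of "q (\<alpha> (Suc k))" "q (\<alpha> k)" x] by linarith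
      also have "\<dots> \<le> (1/2) ^ k" by (simp add: power_add)
      finally show ?case using Suc by simp
    qed simp
    have lim: "(\<lambda>k. q (\<alpha> k)) \<longlonglongrightarrow> p \<alpha>"
      using p(1)[of \<alpha>] unfolding approx .
    have pow: "(\<lambda>k. (1/2 :: real) ^ (k + 2)) \<longlonglongrightarrow> 0"
      by (intro LIMSEQ_ignore_initial_segment LIMSEQ_power_zero) simp
    have "(\<lambda>k. dist (q (\<alpha> k)) x) \<longlonglongrightarrow> 0"
      by (rule tendsto_sandwich[OF _ _ tendsto_const pow])
        (rule always_eventually, rule allI, rule zero_le_dist less_imp_le[OF \<alpha>])+
    then have "(\<lambda>k. q (\<alpha> k)) \<longlonglongrightarrow> x" by (rule tendsto_dist_iff[THEN iffD2])
    then show ?thesis using LIMSEQ_unique[OF lim] by blast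
  qed
  then have "surj p" by (metis surjI)
  ultimately show ?thesis using that by blast
qed

section \<open>Strict monotonicity\<close>

context Wijsman_sublattices
begin

text \<open>If \<open>x\<close> lies at distance more than \<open>e/2\<close> from \<open>F\<close>, then the same \<open>x\<close> and bound work for all nearby \<open>G\<close>,
  and no point of the ball of radius \<open>e/2\<close> about \<open>x\<close> belongs to such a \<open>G\<close>.\<close>

lemma closedin_membership:
  "closedin (prod_topology (Subl_topology d) euclidean) {(F, x). F \<in> Subl \<and> x \<in> F}"
proof -
  let ?N = "Subl \<times> UNIV - {(F, x :: 'a). F \<in> Subl \<and> x \<in> F}"
  have "openin (prod_topology (Subl_topology d) euclidean) ?N"
    unfolding openin_prod_topology_alt
  proof (intro allI impI)
    fix F x assume "(F, x) \<in> ?N"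
    then have F: "F \<in> Subl" "x \<notin> F" by auto
    then have "open (- F)" "x \<in> - F" using SublD(1) by auto
    then obtain e where e: "e > 0" "mball x e \<subseteq> - F" using open_contains_mball by blast
    then have "\<not> setd x F < e" using setd_less_iff[OF F(1)] by auto
    then have far: "e/2 < setd x F" using e(1) by linarith
    have "openin (Subl_topology d) {G \<in> Subl. setd x G \<in> {e/2<..}}" by (rule openin_setd) simp
    moreover have "{G \<in> Subl. setd x G \<in> {e/2<..}} \<times> mball x (e/2) \<subseteq> ?N"
    proof (rule subsetI)
      fix z assume "z \<in> {G \<in> Subl. setd x G \<in> {e/2<..}} \<times> mball x (e/2)"
      then obtain G y where z: "z = (G, y)" and G: "G \<in> Subl" "setd x G \<in> {e/2<..}"
          and y: "y \<in> mball x (e/2)"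
        by blast
      have "y \<notin> G" using G y setd_less_iff[OF G(1), of x "e/2"] by auto
      then show "z \<in> ?N" using z G by auto
    qed
    ultimately show "\<exists>U V. openin (Subl_topology d) U \<and> openin euclidean V \<and> F \<in> U \<and> x \<in> V \<and> U \<times> V \<subseteq> ?N"
      using far F e open_mball[of x "e/2"]
      by (intro exI[of _ "{G \<in> Subl. setd x G \<in> {e/2<..}}"] exI[of _ "mball x (e/2)"]) auto
  qed
  then show ?thesis by (auto simp: closedin_def)
qed

lemma closedin_membership_continuous:
  fixes g :: "'c::topological_space \<Rightarrow> 'a"
  assumes "continuous_on UNIV g"
  shows "closedin (prod_topology (Subl_topology d) euclidean) {(F, \<alpha>). F \<in> Subl \<and> g \<alpha> \<in> F}"
proof -
  have "continuous_map (prod_topology (Subl_topology d) euclidean) euclidean (\<lambda>z. g (snd z))"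
    using continuous_map_compose[OF continuous_map_snd, of euclidean euclidean g] assms
    by (simp add: o_def)
  then have "continuous_map (prod_topology (Subl_topology d) euclidean)
      (prod_topology (Subl_topology d) euclidean) (\<lambda>z. (fst z, g (snd z)))"
    by (intro continuous_map_pairedI continuous_map_fst)
  from closedin_continuous_map_preimage[OF this closedin_membership]
  have "closedin (prod_topology (Subl_topology d) euclidean)
    {z \<in> topspace (prod_topology (Subl_topology d) euclidean).
      (fst z, g (snd z)) \<in> {(F, x). F \<in> Subl \<and> x \<in> F}}" .
  moreover have "\<dots> = {(F, \<alpha>). F \<in> Subl \<and> g \<alpha> \<in> F}" by auto
  ultimately show ?thesis by simp
qed

text \<open>The witnesses \<open>(x, y)\<close> against strict monotonicity form a closed subset of the product of the space of
  sublattices with the square of the Banach lattice. Pulling it back along a continuous surjection from the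
  Baire space gives a closed set with the same projection.\<close>

lemma coanalytic_in_strictly_monotone:
  "coanalytic_in (Subl_topology d) {F \<in> Subl. strictly_monotone F}"
proof -
  obtain D :: "'a set" where "countable D" "closure D = UNIV" using countable_dense .
  then have "countable (D \<times> D)" "closure (D \<times> D) = UNIV" by (auto simp: closure_Times)
  then obtain p :: "(nat \<Rightarrow> nat) \<Rightarrow> 'a \<times> 'a" where p: "continuous_on UNIV p" "surj p"
    using Baire_space_continuous_surjection by blast
  define K where "K = {\<alpha>. 0 \<le> snd (p \<alpha>)} \<inter> {\<alpha>. snd (p \<alpha>) \<le> fst (p \<alpha>)} \<inter>
      {\<alpha>. norm (snd (p \<alpha>)) = 1} \<inter> {\<alpha>. norm (fst (p \<alpha>)) \<le> norm (fst (p \<alpha>) - snd (p \<alpha>))}"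
  have "closed K"
    unfolding K_def using p(1)
    by (intro closed_Int closed_Collect_le_lattice closed_Collect_le closed_Collect_eq continuous_intros) auto
  define C where "C = {(F, \<alpha>). F \<in> Subl \<and> fst (p \<alpha>) \<in> F} \<inter> {(F, \<alpha>). F \<in> Subl \<and> snd (p \<alpha>) \<in> F} \<inter> Subl \<times> K"
  have "closedin (prod_topology (Subl_topology d) euclidean) (Subl \<times> K)"
    using \<open>closed K\<close> closedin_topspace[of "Subl_topology d"] by (simp add: closedin_prod_Times_iff)
  then have "closedin (prod_topology (Subl_topology d) euclidean) C"
    unfolding C_def using p(1)
    by (intro closedin_Int closedin_membership_continuous continuous_intros)
  moreover have "Subl - {F \<in> Subl. strictly_monotone F} = fst ` C"
  proof (intro antisym subsetI)
    fix F :: "'a set" assume "F \<in> Subl - {F \<in> Subl. strictly_monotone F}"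
    then have F: "F \<in> Subl" "\<not> strictly_monotone F" by auto
    then obtain x y where xy: "x \<in> F" "y \<in> F" "0 \<le> y" "y \<le> x" "norm y = 1" "norm x \<le> norm (x - y)"
      unfolding not_strictly_monotone_iff[OF F(1)] by blast
    obtain \<alpha> where "p \<alpha> = (x, y)" using p(2) by (metis surjD)
    then have "(F, \<alpha>) \<in> C" using F xy by (auto simp: C_def K_def)
    then show "F \<in> fst ` C" by force
  next
    fix F assume "F \<in> fst ` C"
    then obtain \<alpha> where F: "F \<in> Subl" "fst (p \<alpha>) \<in> F" "snd (p \<alpha>) \<in> F" "\<alpha> \<in> K" by (auto simp: C_def)
    then have "\<not> strictly_monotone F"
      unfolding not_strictly_monotone_iff[OF F(1)] K_def by blast
    then show "F \<in> Subl - {F \<in> Subl. strictly_monotone F}" using F(1) by blast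
  qed
  ultimately show ?thesis
    unfolding coanalytic_in_def analytic_in_def by auto
qed

end

section \<open>The complexity of the classes\<close>

theorem theorem6p8:
  fixes d :: "'a::banach_lattice \<Rightarrow> 'a \<Rightarrow> real"
  assumes separable: "separable_space (euclidean :: 'a topology)"
    and metric: "Metric_space UNIV d"
    and compatible: "Metric_space.mtopology UNIV d = (euclidean :: 'a topology)"
  shows
    "(\<forall>\<epsilon>\<in>\<rat>. 0 < \<epsilon> \<and> \<epsilon> \<le> 1 \<longrightarrow>
        Baire_class_1 (Subl_topology d) (\<lambda>F. sigma_mod F \<epsilon>) \<and>
        fsigma_in (Subl_topology d) {F \<in> Subl. sigma_mod F \<epsilon> > 0}) \<and>
     (\<forall>\<tau>\<in>\<rat>. 0 < \<tau> \<and> \<tau> \<le> 1 \<longrightarrow>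
        Baire_class_1 (Subl_topology d) (\<lambda>F. rho_mod F \<tau>) \<and>
        (\<forall>r\<in>\<rat>. fsigma_in (Subl_topology d) {F \<in> Subl. rho_mod F \<tau> < r})) \<and>
     Pi03_in (Subl_topology d) {F \<in> Subl. uniformly_monotone F} \<and>
     Pi03_in (Subl_topology d) {F \<in> Subl. order_uniformly_smooth F} \<and>
     coanalytic_in (Subl_topology d) {F \<in> Subl. strictly_monotone F}"
proof -
  interpret Wijsman_sublattices d
    by (intro Wijsman_sublattices.intro Wijsman_sublattices_axioms.intro assms)
  have sigma: "Baire_class_1 (Subl_topology d) (\<lambda>F. sigma_mod F \<epsilon>) \<and>
      fsigma_in (Subl_topology d) {F \<in> Subl. sigma_mod F \<epsilon> > 0}" if "0 < \<epsilon> \<and> \<epsilon> \<le> 1" for \<epsilon>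
    using that Baire_class_1_sigma_mod fsigma_in_sigma_mod_pos by blast
  have rho: "Baire_class_1 (Subl_topology d) (\<lambda>F. rho_mod F \<tau>) \<and>
      (\<forall>r\<in>\<rat>. fsigma_in (Subl_topology d) {F \<in> Subl. rho_mod F \<tau> < r})" if "0 < \<tau> \<and> \<tau> \<le> 1" for \<tau>
  proof -
    have "0 \<le> \<tau>" using that by simp
    then show ?thesis using Baire_class_1_rho_mod fsigma_in_rho_mod_less by blast
  qed
  show ?thesis
    using sigma rho Pi03_in_uniformly_monotone Pi03_in_order_uniformly_smooth
      coanalytic_in_strictly_monotone by blast
qed

end
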